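(* Let $r\in\mathbb R$ and let $(\epsilon,\omega)\in\{(0,0),(0,1),(1,0),(-1,0)\}\cup\{(1,\alpha_+):\alpha_+>0\}\cup\{(-1,\alpha_-):\alpha_->0\}$. Define on $\mathfrak g=M\oplus H\oplus C\oplus\mathbf P\oplus\mathbf D\oplus\mathbf K\oplus\mathbf J$ the bracket with non-trivial commutators (besides those with $\mathbf J$) $$[\mathbf D,\mathbf K]=C,\quad [\mathbf K,H]=\mathbf P,\quad [\mathbf D,\mathbf P]=M,\quad [C,H]=M-r\,C,\quad [H,\mathbf D]=r\,\mathbf D,$$ $$[H,\mathbf P]=\epsilon\,\mathbf K+\omega\,\mathbf P,\quad [H,M]=\epsilon\, C+(\omega+r)\, M .$$ Then $\mathfrak g$ is a Lie algebra and, with $\mathfrak h=C\oplus\mathbf D\oplus\mathbf K\oplus\mathbf J$ and $\mathfrak i=M\oplus C\oplus\mathbf D$, the triplet $(\mathfrak g,\mathfrak h,\mathfrak i)$ is a projectable triplet which lifts the galilean kinematical Klein pair with commutators $[\mathbf K,H]=\mathbf P$, $[H,\mathbf P]=\epsilon\mathbf K+\omega\mathbf P$. The Klein pair $(\mathfrak g,\mathfrak h)$ is leibnizian for $\boldsymbol\xi=M$, $\boldsymbol\psi=-H^*$, $\boldsymbol\gamma=\mathbf P^*\otimes\mathbf P^*$, and it is reductive for $r=0$ and non-reductive for $r\neq0$.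
   Context: Here $J_{ij}=-J_{ji}$ ($1\le i,j\le d$) span $\mathbf J\simeq\mathfrak{so}(d)$ with $[J_{ij},J_{kl}]=\delta_{jk}J_{il}-\delta_{jl}J_{ik}+\delta_{il}J_{jk}-\delta_{ik}J_{jl}$; $\mathbf P,\mathbf D,\mathbf K$ are spanned by $P_i,D_i,K_i$, each satisfying $[J_{ij},V_k]=-\delta_{ik}V_j+\delta_{jk}V_i$; $M,H,C$ are single generators commuting with $\mathbf J$; $d\ge1$. Shorthand: $[\mathbf D,\mathbf K]=C$ means $[D_i,K_j]=\delta_{ij}C$; $[\mathbf K,H]=\mathbf P$ means $[K_i,H]=P_i$; etc. A Klein pair is a real Lie algebra $\mathfrak g$ with a subalgebra $\mathfrak h$; it is effective if $\mathfrak h$ contains no non-zero ideal of $\mathfrak g$, and reductive if $\mathfrak h$ has a vector space complement $\mathfrak p$ in $\mathfrak g$ with $[\mathfrak h,\mathfrak p]\subset\mathfrak p$. A projectable triplet $(\mathfrak g,\mathfrak h,\mathfrak i)$ is an effective Klein pair $(\mathfrak g,\mathfrak h)$ with a non-trivial ideal $\mathfrak i\subset\mathfrak g$ such that, with $\mathfrak j=\mathfrak h\cap\mathfrak i$, the quotient Klein pair $(\mathfrak g/\mathfrak i,\mathfrak h/\mathfrak j)$ is effective; it lifts any Klein pair isomorphic to $(\mathfrak g/\mathfrak i,\mathfrak h/\mathfrak j)$. The galilean kinematical Klein pair is on $H\oplus\mathbf P\oplus\mathbf K\oplus\mathbf J$ with subalgebra $\mathbf K\oplus\mathbf J$. The adjoint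 action of $\mathfrak h$ induces an action $\mathrm{ad}_{\mathfrak h}$ on $\mathfrak g/\mathfrak h\simeq\mathrm{Span}\{M,H,P_i\}$ (dual basis $M^*,H^*,P_i^*$) and on its tensors; $\mathbf P^*\otimes\mathbf P^*=\sum_iP_i^*\otimes P_i^*$ restricted to $\ker\boldsymbol\psi$. The pair is leibnizian for $(\boldsymbol\xi,\boldsymbol\psi,\boldsymbol\gamma)$ if $\boldsymbol\xi\in\mathfrak g/\mathfrak h$ is a non-zero invariant vector, $\boldsymbol\psi$ a non-zero invariant linear form with $\boldsymbol\psi(\boldsymbol\xi)=0$, and $\boldsymbol\gamma$ a symmetric positive semi-definite invariant bilinear form on $\ker\boldsymbol\psi$ with radical spanned by $\boldsymbol\xi$. *)

theory Defs
  imports "HOL-Analysis.Analysis" "HOL-Algebra.QuotRing" "HOL-Algebra.Module"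
begin

section \<open>Real Lie algebras and Klein pairs\<close>

definition real_ring :: "real ring" where
  "real_ring = \<lparr>carrier = UNIV, mult = (*), one = 1, zero = 0, add = (+)\<rparr>"

text \<open>
  A real Lie algebra is carried by the HOL-Algebra record of real modules. As in the library
  locale of associative algebras, the multiplication of the record is the product of the algebra,
  here the Lie bracket: \<open>x \<otimes>\<^bsub>L\<^esub> y\<close> stands for $[x,y]$. The field \<open>one\<close> is never used.
\<close>

locale lie_algebra = Module.module real_ring L for L (structure) +
  assumes bracket_closed: "\<lbrakk>x \<in> carrier L; y \<in> carrier L\<rbrakk> \<Longrightarrow> x \<otimes> y \<in> carrier L"
    and bracket_add_left:
      "\<lbrakk>x \<in> carrier L; y \<in> carrier L; z \<in> carrier L\<rbrakk> \<Longrightarrow> (x \<oplus> y) \<otimes> z = x \<otimes> z \<oplus> y \<otimes> z"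
    and bracket_add_right:
      "\<lbrakk>x \<in> carrier L; y \<in> carrier L; z \<in> carrier L\<rbrakk> \<Longrightarrow> z \<otimes> (x \<oplus> y) = z \<otimes> x \<oplus> z \<otimes> y"
    and bracket_smult_left:
      "\<lbrakk>x \<in> carrier L; y \<in> carrier L\<rbrakk> \<Longrightarrow> (a \<odot> x) \<otimes> y = a \<odot> (x \<otimes> y)"
    and bracket_smult_right:
      "\<lbrakk>x \<in> carrier L; y \<in> carrier L\<rbrakk> \<Longrightarrow> x \<otimes> (a \<odot> y) = a \<odot> (x \<otimes> y)"
    and bracket_self: "x \<in> carrier L \<Longrightarrow> x \<otimes> x = \<zero>"
    and jacobi:
      "\<lbrakk>x \<in> carrier L; y \<in> carrier L; z \<in> carrier L\<rbrakk> \<Longrightarrow>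
        x \<otimes> (y \<otimes> z) \<oplus> y \<otimes> (z \<otimes> x) \<oplus> z \<otimes> (x \<otimes> y) = \<zero>"

definition lie_subalgebra :: "'a set \<Rightarrow> (real, 'a) module \<Rightarrow> bool" where
  "lie_subalgebra h L \<longleftrightarrow>
     submodule h real_ring L \<and> (\<forall>x\<in>h. \<forall>y\<in>h. x \<otimes>\<^bsub>L\<^esub> y \<in> h)"

definition lie_ideal :: "'a set \<Rightarrow> (real, 'a) module \<Rightarrow> bool" where
  "lie_ideal i L \<longleftrightarrow>
     submodule i real_ring L \<and> (\<forall>x\<in>carrier L. \<forall>y\<in>i. x \<otimes>\<^bsub>L\<^esub> y \<in> i)"

definition klein_pair :: "(real, 'a) module \<Rightarrow> 'a set \<Rightarrow> bool" where
  "klein_pair L h \<longleftrightarrow> lie_algebra L \<and> lie_subalgebra h L"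

definition effective_klein_pair :: "(real, 'a) module \<Rightarrow> 'a set \<Rightarrow> bool" where
  "effective_klein_pair L h \<longleftrightarrow>
     klein_pair L h \<and> (\<forall>a. lie_ideal a L \<and> a \<subseteq> h \<longrightarrow> a = {\<zero>\<^bsub>L\<^esub>})"

definition reductive_klein_pair :: "(real, 'a) module \<Rightarrow> 'a set \<Rightarrow> bool" where
  "reductive_klein_pair L h \<longleftrightarrow>
     klein_pair L h \<and>
     (\<exists>p. submodule p real_ring L \<and> h \<inter> p = {\<zero>\<^bsub>L\<^esub>} \<and> h <+>\<^bsub>L\<^esub> p = carrier L \<and>
          (\<forall>x\<in>h. \<forall>y\<in>p. x \<otimes>\<^bsub>L\<^esub> y \<in> p))"

text \<open>
  Quotient by a subspace \<open>N\<close>, with cosets as elements. The vector space operations are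
  meaningful for every subspace (they are used for $\mathfrak g/\mathfrak h$), the bracket
  only if \<open>N\<close> is an ideal.
\<close>

definition lie_quotient :: "(real, 'a) module \<Rightarrow> 'a set \<Rightarrow> (real, 'a set) module" where
  "lie_quotient L N =
     \<lparr>carrier = a_rcosets\<^bsub>L\<^esub> N, mult = rcoset_mult L N, one = undefined,
      zero = N, add = set_add L,
      smult = (\<lambda>a S. \<Union>x\<in>S. N +>\<^bsub>L\<^esub> (a \<odot>\<^bsub>L\<^esub> x))\<rparr>"

definition lie_iso :: "(real, 'a) module \<Rightarrow> (real, 'b) module \<Rightarrow> ('a \<Rightarrow> 'b) \<Rightarrow> bool" where
  "lie_iso L L' f \<longleftrightarrow>
     bij_betw f (carrier L) (carrier L') \<and>
     (\<forall>x\<in>carrier L. \<forall>y\<in>carrier L. f (x \<oplus>\<^bsub>L\<^esub> y) = f x \<oplus>\<^bsub>L'\<^esub> f y) \<and>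
     (\<forall>a. \<forall>x\<in>carrier L. f (a \<odot>\<^bsub>L\<^esub> x) = a \<odot>\<^bsub>L'\<^esub> f x) \<and>
     (\<forall>x\<in>carrier L. \<forall>y\<in>carrier L. f (x \<otimes>\<^bsub>L\<^esub> y) = f x \<otimes>\<^bsub>L'\<^esub> f y)"

definition klein_pairs_isomorphic ::
    "(real, 'a) module \<Rightarrow> 'a set \<Rightarrow> (real, 'b) module \<Rightarrow> 'b set \<Rightarrow> bool" where
  "klein_pairs_isomorphic L h L' h' \<longleftrightarrow> (\<exists>f. lie_iso L L' f \<and> f ` h = h')"

text \<open>
  For $\mathfrak j=\mathfrak h\cap\mathfrak i$, the quotient $\mathfrak h/\mathfrak j$ is regarded
  as a subalgebra of $\mathfrak g/\mathfrak i$ in the standard way, as the image of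
  $\mathfrak h$ under the projection.
\<close>

definition quotient_subalgebra :: "(real, 'a) module \<Rightarrow> 'a set \<Rightarrow> 'a set \<Rightarrow> 'a set set" where
  "quotient_subalgebra L h i = (\<lambda>x. i +>\<^bsub>L\<^esub> x) ` h"

definition projectable_triplet :: "(real, 'a) module \<Rightarrow> 'a set \<Rightarrow> 'a set \<Rightarrow> bool" where
  "projectable_triplet L h i \<longleftrightarrow>
     effective_klein_pair L h \<and>
     lie_ideal i L \<and> i \<noteq> {\<zero>\<^bsub>L\<^esub>} \<and> i \<noteq> carrier L \<and>
     effective_klein_pair (lie_quotient L i) (quotient_subalgebra L h i)"

definition lifts_klein_pair ::
    "(real, 'a) module \<Rightarrow> 'a set \<Rightarrow> 'a set \<Rightarrow> (real, 'b) module \<Rightarrow> 'b set \<Rightarrow> bool" where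
  "lifts_klein_pair L h i L' h' \<longleftrightarrow>
     projectable_triplet L h i \<and> klein_pair L' h' \<and>
     klein_pairs_isomorphic (lie_quotient L i) (quotient_subalgebra L h i) L' h'"


section \<open>Leibnizian Klein pairs\<close>

text \<open>The action $\mathrm{ad}_{\mathfrak h}$ of \<open>x \<in> h\<close> on $\mathfrak g/\mathfrak h$.\<close>

definition quotient_ad :: "(real, 'a) module \<Rightarrow> 'a set \<Rightarrow> 'a \<Rightarrow> 'a set \<Rightarrow> 'a set" where
  "quotient_ad L h x S = (\<Union>y\<in>S. h +>\<^bsub>L\<^esub> (x \<otimes>\<^bsub>L\<^esub> y))"

definition linear_form_on :: "(real, 'v) module \<Rightarrow> 'v set \<Rightarrow> ('v \<Rightarrow> real) \<Rightarrow> bool" where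
  "linear_form_on V N f \<longleftrightarrow>
     (\<forall>u\<in>N. \<forall>v\<in>N. f (u \<oplus>\<^bsub>V\<^esub> v) = f u + f v) \<and> (\<forall>a. \<forall>u\<in>N. f (a \<odot>\<^bsub>V\<^esub> u) = a * f u)"

definition form_kernel :: "(real, 'v) module \<Rightarrow> ('v \<Rightarrow> real) \<Rightarrow> 'v set" where
  "form_kernel V f = {u \<in> carrier V. f u = 0}"

definition leibnizian ::
    "(real, 'a) module \<Rightarrow> 'a set \<Rightarrow> 'a set \<Rightarrow> ('a set \<Rightarrow> real) \<Rightarrow> ('a set \<Rightarrow> 'a set \<Rightarrow> real) \<Rightarrow> bool"
  where
  "leibnizian L h \<xi> \<psi> \<gamma> \<longleftrightarrow>
     (let V = lie_quotient L h; N = form_kernel V \<psi>; act = quotient_ad L h in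
       klein_pair L h \<and>
       \<xi> \<in> carrier V \<and> \<xi> \<noteq> \<zero>\<^bsub>V\<^esub> \<and> (\<forall>x\<in>h. act x \<xi> = \<zero>\<^bsub>V\<^esub>) \<and>
       linear_form_on V (carrier V) \<psi> \<and> (\<exists>u\<in>carrier V. \<psi> u \<noteq> 0) \<and>
       (\<forall>x\<in>h. \<forall>u\<in>carrier V. \<psi> (act x u) = 0) \<and>
       \<psi> \<xi> = 0 \<and>
       (\<forall>u\<in>N. linear_form_on V N (\<gamma> u)) \<and>
       (\<forall>u\<in>N. \<forall>v\<in>N. \<gamma> u v = \<gamma> v u) \<and>
       (\<forall>u\<in>N. \<gamma> u u \<ge> 0) \<and>
       (\<forall>x\<in>h. \<forall>u\<in>N. \<forall>v\<in>N. \<gamma> (act x u) v + \<gamma> u (act x v) = 0) \<and>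
       {u \<in> N. \<forall>v\<in>N. \<gamma> u v = 0} = {a \<odot>\<^bsub>V\<^esub> \<xi> | a. True})"


section \<open>The kinematical and ambient Lie algebras\<close>

text \<open>
  The dimension \<open>d\<close> is \<open>CARD('n)\<close>. The algebra $\mathbf J\simeq\mathfrak{so}(d)$ consists of the
  skew-symmetric matrices, $J_{ij}$ being $E_{ij}-E_{ji}$ (\<open>gen_J\<close> below), with the matrix
  commutator as bracket and the matrix-vector product as action on the vector modules. The
  brackets below are the bilinear extensions of the commutators of the generators; these
  commutators are verified in the lemmas at the end.
\<close>

definition so_mat :: "(real^'n^'n) set" where
  "so_mat = {A. transpose A = - A}"

definition lie_on :: "'v::real_vector set \<Rightarrow> ('v \<Rightarrow> 'v \<Rightarrow> 'v) \<Rightarrow> (real, 'v) module" where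
  "lie_on V br =
     \<lparr>carrier = V, mult = br, one = undefined, zero = 0, add = (+), smult = (*\<^sub>R)\<rparr>"

text \<open>Components in the order $H,\mathbf P,\mathbf K,\mathbf J$.\<close>

type_synonym 'n kin = "real \<times> (real^'n) \<times> (real^'n) \<times> (real^'n^'n)"

fun gal_bracket :: "real \<Rightarrow> real \<Rightarrow> 'n::finite kin \<Rightarrow> 'n kin \<Rightarrow> 'n kin" where
  "gal_bracket \<epsilon> \<omega> (t, p, k, A) (t', p', k', A') =
     (0,
      (t' *\<^sub>R k - t *\<^sub>R k') + \<omega> *\<^sub>R (t *\<^sub>R p' - t' *\<^sub>R p) + (A *v p' - A' *v p),
      \<epsilon> *\<^sub>R (t *\<^sub>R p' - t' *\<^sub>R p) + (A *v k' - A' *v k),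
      A ** A' - A' ** A)"

definition gal_algebra :: "real \<Rightarrow> real \<Rightarrow> (real, 'n::finite kin) module" where
  "gal_algebra \<epsilon> \<omega> = lie_on {(t, p, k, A). A \<in> so_mat} (gal_bracket \<epsilon> \<omega>)"

definition gal_KJ :: "'n::finite kin set" where
  "gal_KJ = {(t, p, k, A). t = 0 \<and> p = 0 \<and> A \<in> so_mat}"

text \<open>Components in the order $M,H,C,\mathbf P,\mathbf D,\mathbf K,\mathbf J$.\<close>

type_synonym 'n amb =
  "real \<times> real \<times> real \<times> (real^'n) \<times> (real^'n) \<times> (real^'n) \<times> (real^'n^'n)"

fun amb_bracket :: "real \<Rightarrow> real \<Rightarrow> real \<Rightarrow> 'n::finite amb \<Rightarrow> 'n amb \<Rightarrow> 'n amb" where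
  "amb_bracket r \<epsilon> \<omega> (m, t, c, p, d, k, A) (m', t', c', p', d', k', A') =
     ((d \<bullet> p' - d' \<bullet> p) + (c * t' - c' * t) + (\<omega> + r) * (t * m' - t' * m),
      0,
      (d \<bullet> k' - d' \<bullet> k) - r * (c * t' - c' * t) + \<epsilon> * (t * m' - t' * m),
      (t' *\<^sub>R k - t *\<^sub>R k') + \<omega> *\<^sub>R (t *\<^sub>R p' - t' *\<^sub>R p) + (A *v p' - A' *v p),
      r *\<^sub>R (t *\<^sub>R d' - t' *\<^sub>R d) + (A *v d' - A' *v d),
      \<epsilon> *\<^sub>R (t *\<^sub>R p' - t' *\<^sub>R p) + (A *v k' - A' *v k),
      A ** A' - A' ** A)"

definition amb_algebra :: "real \<Rightarrow> real \<Rightarrow> real \<Rightarrow> (real, 'n::finite amb) module" where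
  "amb_algebra r \<epsilon> \<omega> = lie_on {(m, t, c, p, d, k, A). A \<in> so_mat} (amb_bracket r \<epsilon> \<omega>)"

definition amb_CDKJ :: "'n::finite amb set" where
  "amb_CDKJ = {(m, t, c, p, d, k, A). m = 0 \<and> t = 0 \<and> p = 0 \<and> A \<in> so_mat}"

definition amb_MCD :: "'n::finite amb set" where
  "amb_MCD = {(m, t, c, p, d, k, A). t = 0 \<and> p = 0 \<and> k = 0 \<and> A = 0}"

definition gen_M :: "'n::finite amb" where "gen_M = (1, 0, 0, 0, 0, 0, 0)"
definition gen_H :: "'n::finite amb" where "gen_H = (0, 1, 0, 0, 0, 0, 0)"
definition gen_C :: "'n::finite amb" where "gen_C = (0, 0, 1, 0, 0, 0, 0)"
definition gen_P :: "'n::finite \<Rightarrow> 'n amb" where "gen_P i = (0, 0, 0, axis i 1, 0, 0, 0)"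
definition gen_D :: "'n::finite \<Rightarrow> 'n amb" where "gen_D i = (0, 0, 0, 0, axis i 1, 0, 0)"
definition gen_K :: "'n::finite \<Rightarrow> 'n amb" where "gen_K i = (0, 0, 0, 0, 0, axis i 1, 0)"
definition gen_J :: "'n::finite \<Rightarrow> 'n \<Rightarrow> 'n amb" where
  "gen_J i j = (0, 0, 0, 0, 0, 0, axis i (axis j 1) - axis j (axis i 1))"

fun coord_H :: "'n::finite amb \<Rightarrow> real" where
  "coord_H (m, t, c, p, d, k, A) = t"

fun coord_P :: "'n::finite \<Rightarrow> 'n amb \<Rightarrow> real" where
  "coord_P i (m, t, c, p, d, k, A) = p $ i"

text \<open>
  Dual basis vectors $H^*$ and $P_i^*$ on $\mathfrak g/\mathfrak h$: the coordinate in question is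
  constant on each coset of $\mathfrak h=C\oplus\mathbf D\oplus\mathbf K\oplus\mathbf J$
  (lemmas \<open>dual_H_coset\<close> and \<open>dual_P_coset\<close>).
\<close>

definition dual_H :: "'n::finite amb set \<Rightarrow> real" where
  "dual_H S = the_elem (coord_H ` S)"

definition dual_P :: "'n::finite \<Rightarrow> 'n amb set \<Rightarrow> real" where
  "dual_P i S = the_elem (coord_P i ` S)"


subsection \<open>Generators\<close>

abbreviation delta :: "'n \<Rightarrow> 'n \<Rightarrow> real" where
  "delta i j \<equiv> (if i = j then 1 else 0)"

lemmas gen_defs = gen_M_def gen_H_def gen_C_def gen_P_def gen_D_def gen_K_def gen_J_def

lemma so_mat_decomp:
  fixes A :: "real^'n::finite^'n"
  assumes "A \<in> so_mat"
  shows "A = (1/2) *\<^sub>R (\<Sum>i\<in>UNIV. \<Sum>j\<in>UNIV. (A $ i $ j) *\<^sub>R (axis i (axis j 1) - axis j (axis i 1)))"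
proof -
  have skew: "A $ j $ i = - (A $ i $ j)" for i j
  proof -
    have "transpose A $ i $ j = (- A) $ i $ j"
      using assms by (simp add: so_mat_def)
    then show ?thesis by (simp add: transpose_def)
  qed
  have "(\<Sum>i\<in>UNIV. \<Sum>j\<in>UNIV. (A $ i $ j) *\<^sub>R (axis i (axis j 1) - axis j (axis i 1))) $ k $ l
      = 2 * A $ k $ l" for k l
  proof -
    have 1: "axis i (axis j (1::real)) $ k $ l = (if i = k then if j = l then 1 else 0 else 0)" for i j
      by (simp add: axis_def)
    have "(\<Sum>i\<in>UNIV. \<Sum>j\<in>UNIV. (A $ i $ j) *\<^sub>R (axis i (axis j 1) - axis j (axis i 1))) $ k $ l
        = (\<Sum>i\<in>UNIV. \<Sum>j\<in>UNIV. A $ i $ j * (if i = k then if j = l then 1 else 0 else 0))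
        - (\<Sum>i\<in>UNIV. \<Sum>j\<in>UNIV. A $ i $ j * (if j = k then if i = l then 1 else 0 else 0))"
      by (simp add: 1 sum_component sum_subtractf right_diff_distrib)
    also have "(\<Sum>i\<in>UNIV. \<Sum>j\<in>UNIV. A $ i $ j * (if i = k then if j = l then 1 else 0 else 0))
        = (\<Sum>i\<in>UNIV. if i = k then A $ i $ l else 0)"
      by (rule sum.cong) (auto simp: if_distrib[of "(*) _"] cong: if_cong)
    also have "(\<Sum>i\<in>UNIV. \<Sum>j\<in>UNIV. A $ i $ j * (if j = k then if i = l then 1 else 0 else 0))
        = (\<Sum>i\<in>UNIV. if i = l then A $ i $ k else 0)"
      by (rule sum.cong) (auto simp: if_distrib[of "(*) _"] cong: if_cong)
    finally show ?thesis by (simp add: skew[of l k])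
  qed
  then show ?thesis by (simp add: vec_eq_iff)
qed

lemma matrix_unit_nth: "axis i (axis j (1::real)) $ k $ l = delta i k * delta j l"
  by (simp add: axis_def)

lemma matrix_unit_mult:
  "axis i (axis j 1) ** axis k (axis l 1) = (delta j k *\<^sub>R axis i (axis l 1) :: real^'n::finite^'n)"
  by (simp add: vec_eq_iff matrix_matrix_mult_def matrix_unit_nth mult_delta_left mult_delta_right)

lemma matrix_unit_vector_mult:
  "axis i (axis j 1) *v axis k 1 = (delta j k *\<^sub>R axis i 1 :: real^'n::finite)"
  by (simp add: vec_eq_iff matrix_vector_mult_def matrix_unit_nth mult_delta_left mult_delta_right
        axis_def)

lemma matrix_mult_bilinear:
  fixes A B C :: "real^'n::finite^'n"
  shows "(A + B) ** C = A ** C + B ** C" "C ** (A + B) = C ** A + C ** B"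
    "(A - B) ** C = A ** C - B ** C" "C ** (A - B) = C ** A - C ** B"
    "(a *\<^sub>R A) ** C = a *\<^sub>R (A ** C)" "C ** (a *\<^sub>R A) = a *\<^sub>R (C ** A)"
  by (simp_all add: vec_eq_iff matrix_matrix_mult_def sum.distrib sum_subtractf sum_distrib_left
        algebra_simps)

lemma gen_J_antisym: "gen_J i j = - gen_J j i"
  by (simp add: gen_defs)

lemma amb_commutators_J:
  "amb_bracket r \<epsilon> \<omega> (gen_J i j) (gen_J k l) =
     delta j k *\<^sub>R gen_J i l - delta j l *\<^sub>R gen_J i k
     + delta i l *\<^sub>R gen_J j k - delta i k *\<^sub>R gen_J j l"
  "amb_bracket r \<epsilon> \<omega> (gen_J i j) (gen_P k) = - delta i k *\<^sub>R gen_P j + delta j k *\<^sub>R gen_P i"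
  "amb_bracket r \<epsilon> \<omega> (gen_J i j) (gen_D k) = - delta i k *\<^sub>R gen_D j + delta j k *\<^sub>R gen_D i"
  "amb_bracket r \<epsilon> \<omega> (gen_J i j) (gen_K k) = - delta i k *\<^sub>R gen_K j + delta j k *\<^sub>R gen_K i"
  "amb_bracket r \<epsilon> \<omega> (gen_J i j) gen_M = 0"
  "amb_bracket r \<epsilon> \<omega> (gen_J i j) gen_H = 0"
  "amb_bracket r \<epsilon> \<omega> (gen_J i j) gen_C = 0"
  by (auto simp: gen_defs matrix_vector_mult_diff_rdistrib matrix_unit_mult
        matrix_unit_vector_mult matrix_mult_bilinear zero_prod_def)

lemma amb_commutators:
  "amb_bracket r \<epsilon> \<omega> (gen_D i) (gen_K j) = delta i j *\<^sub>R gen_C"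
  "amb_bracket r \<epsilon> \<omega> (gen_K i) gen_H = gen_P i"
  "amb_bracket r \<epsilon> \<omega> (gen_D i) (gen_P j) = delta i j *\<^sub>R gen_M"
  "amb_bracket r \<epsilon> \<omega> gen_C gen_H = gen_M - r *\<^sub>R gen_C"
  "amb_bracket r \<epsilon> \<omega> gen_H (gen_D i) = r *\<^sub>R gen_D i"
  "amb_bracket r \<epsilon> \<omega> gen_H (gen_P i) = \<epsilon> *\<^sub>R gen_K i + \<omega> *\<^sub>R gen_P i"
  "amb_bracket r \<epsilon> \<omega> gen_H gen_M = \<epsilon> *\<^sub>R gen_C + (\<omega> + r) *\<^sub>R gen_M"
  by (auto simp: gen_defs inner_axis_axis zero_prod_def)

lemma amb_commutators_trivial:
  "amb_bracket r \<epsilon> \<omega> gen_M gen_C = 0"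
  "amb_bracket r \<epsilon> \<omega> gen_M (gen_P i) = 0"
  "amb_bracket r \<epsilon> \<omega> gen_M (gen_D i) = 0"
  "amb_bracket r \<epsilon> \<omega> gen_M (gen_K i) = 0"
  "amb_bracket r \<epsilon> \<omega> gen_C (gen_P i) = 0"
  "amb_bracket r \<epsilon> \<omega> gen_C (gen_D i) = 0"
  "amb_bracket r \<epsilon> \<omega> gen_C (gen_K i) = 0"
  "amb_bracket r \<epsilon> \<omega> (gen_P i) (gen_P j) = 0"
  "amb_bracket r \<epsilon> \<omega> (gen_P i) (gen_K j) = 0"
  "amb_bracket r \<epsilon> \<omega> (gen_D i) (gen_D j) = 0"
  "amb_bracket r \<epsilon> \<omega> (gen_K i) (gen_K j) = 0"
  by (auto simp: gen_defs zero_prod_def)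

lemma amb_bracket_antisym: "amb_bracket r \<epsilon> \<omega> x y = - amb_bracket r \<epsilon> \<omega> y x"
  by (cases x; cases y) (simp add: algebra_simps)

lemma bilinear_amb_bracket: "bilinear (amb_bracket r \<epsilon> \<omega>)"
proof -
  have lin: "linear (amb_bracket r \<epsilon> \<omega> x)" for x
  proof (rule linearI)
    show "amb_bracket r \<epsilon> \<omega> x (y + z) = amb_bracket r \<epsilon> \<omega> x y + amb_bracket r \<epsilon> \<omega> x z" for y z
      by (cases x; cases y; cases z)
         (simp add: algebra_simps inner_add_left inner_add_right matrix_mult_bilinear)
    show "amb_bracket r \<epsilon> \<omega> x (a *\<^sub>R y) = a *\<^sub>R amb_bracket r \<epsilon> \<omega> x y" for a y
      by (cases x; cases y)
         (simp add: algebra_simps matrix_mult_bilinear scaleR_matrix_vector_assoc)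
  qed
  have "linear (\<lambda>x. amb_bracket r \<epsilon> \<omega> x y)" for y
  proof -
    have "(\<lambda>x. amb_bracket r \<epsilon> \<omega> x y) = (\<lambda>x. - amb_bracket r \<epsilon> \<omega> y x)"
      by (rule ext) (rule amb_bracket_antisym)
    with linear_compose_neg[OF lin[of y]] show ?thesis by metis
  qed
  with lin show ?thesis
    unfolding bilinear_def by blast
qed

text \<open>
  The galilean bracket is the one induced on $H\oplus\mathbf P\oplus\mathbf K\oplus\mathbf J$.
\<close>

lemma gal_bracket_eq:
  "gal_bracket \<epsilon> \<omega> (t, p, k, A) (t', p', k', A') =
     (case amb_bracket r \<epsilon> \<omega> (m, t, c, p, d, k, A) (m', t', c', p', d', k', A') of
        (_, t'', _, p'', _, k'', A'') \<Rightarrow> (t'', p'', k'', A''))"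
  by simp

lemma dual_H_coset: "dual_H (amb_CDKJ +>\<^bsub>amb_algebra r \<epsilon> \<omega>\<^esub> x) = coord_H x"
  and dual_P_coset: "dual_P i (amb_CDKJ +>\<^bsub>amb_algebra r \<epsilon> \<omega>\<^esub> x) = coord_P i x"
proof -
  let ?S = "amb_CDKJ +>\<^bsub>amb_algebra r \<epsilon> \<omega>\<^esub> x"
  have S: "?S = (\<lambda>y. y + x) ` amb_CDKJ"
    by (auto simp: a_r_coset_def' amb_algebra_def lie_on_def)
  have "(0 :: 'a amb) \<in> amb_CDKJ"
    by (simp add: amb_CDKJ_def zero_prod_def so_mat_def transpose_def vec_eq_iff)
  then have "coord_H ` ?S = {coord_H x}" "coord_P i ` ?S = {coord_P i x}"
    unfolding S by (cases x; force simp: amb_CDKJ_def)+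
  then show "dual_H ?S = coord_H x" "dual_P i ?S = coord_P i x"
    by (simp_all add: dual_H_def dual_P_def)
qed

end

theory Submission
  imports Defs
begin

text \<open>
  The ideal $\mathfrak i$ and the subalgebra $\mathfrak h$ are the kernels of the linear projections
  to the components $(H,\mathbf P,\mathbf K,\mathbf J)$ and $(M,H,\mathbf P)$. Hence
  $\mathfrak g/\mathfrak i$ and $\mathfrak g/\mathfrak h$ can be computed in these components,
  and the first projection carries the bracket of $\mathfrak g$ to the galilean one. An ideal inside
  $\mathfrak h$ vanishes because already the brackets of its elements with $H$ and $P_i$ leave
  $\mathfrak h$. For $r=0$ the span of $M$, $H$ and the $P_i$ is a reductive complement. For
  $r\neq0$, an invariant complement $\mathfrak p$ would contain some $H+z$ with
  $z\in\mathfrak h$; then $[D_i,H+z]$ lies in $\mathfrak h\cap\mathfrak p=0$, although its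
  coefficient at $D_i$ is $-r$, since $z$ contributes to it only through a skew-symmetric matrix.
\<close>


section \<open>Lie algebras and their images\<close>

lemma real_ring_simps [simp]:
  "carrier real_ring = UNIV" "mult real_ring = (*)" "one real_ring = 1"
  "zero real_ring = 0" "add real_ring = (+)"
  by (simp_all add: real_ring_def)

lemma cring_real_ring: "cring real_ring"
proof (rule cringI)
  show "abelian_group real_ring"
  proof (rule abelian_groupI)
    fix x
    show "\<exists>y\<in>carrier real_ring. y \<oplus>\<^bsub>real_ring\<^esub> x = \<zero>\<^bsub>real_ring\<^esub>"
      by (rule bexI[of _ "- x"]) simp_all
  qed simp_all
  show "comm_monoid real_ring"
    by (rule comm_monoidI) simp_all
qed (simp add: distrib_right)

text \<open>Scaling by -1 produces the additive inverse, so closure under inverses, which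
  \<open>submodule\<close> demands, follows from the usual subspace conditions.\<close>

lemma submodule_real_iff:
  assumes "Module.module real_ring L"
  shows "submodule N real_ring L \<longleftrightarrow>
    N \<subseteq> carrier L \<and> \<zero>\<^bsub>L\<^esub> \<in> N \<and> (\<forall>x\<in>N. \<forall>y\<in>N. x \<oplus>\<^bsub>L\<^esub> y \<in> N) \<and>
    (\<forall>a. \<forall>x\<in>N. a \<odot>\<^bsub>L\<^esub> x \<in> N)" (is "_ \<longleftrightarrow> ?R")
proof -
  interpret M: Module.module real_ring L by fact
  show ?thesis
  proof
    assume N: "submodule N real_ring L"
    then have "subgroup N (add_monoid L)"
      by (rule submodule.axioms)
    from subgroup.one_closed[OF this] M.submoduleE[OF N] show ?R
      by auto
  next
    assume N: ?R
    have "\<ominus>\<^bsub>L\<^esub> x = (- 1) \<odot>\<^bsub>L\<^esub> x" if "x \<in> N" for x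
    proof (rule M.minus_equality)
      have x: "x \<in> carrier L" using that N by blast
      have "(-1) \<odot>\<^bsub>L\<^esub> x \<oplus>\<^bsub>L\<^esub> x = (-1) \<odot>\<^bsub>L\<^esub> x \<oplus>\<^bsub>L\<^esub> 1 \<odot>\<^bsub>L\<^esub> x"
        using M.smult_one[OF x] by simp
      also have "\<dots> = (-1 + 1) \<odot>\<^bsub>L\<^esub> x"
        using M.smult_l_distr[OF _ _ x, of "-1" 1] by simp
      also have "\<dots> = \<zero>\<^bsub>L\<^esub>"
        using M.smult_l_null[OF x] by simp
      finally show "(-1) \<odot>\<^bsub>L\<^esub> x \<oplus>\<^bsub>L\<^esub> x = \<zero>\<^bsub>L\<^esub>" .
      show "x \<in> carrier L" "(-1) \<odot>\<^bsub>L\<^esub> x \<in> carrier L"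
        using x M.smult_closed[of "-1" x] by auto
    qed
    with N show "submodule N real_ring L"
      by (intro M.submoduleI) auto
  qed
qed

text \<open>The target may be any record. Surjectivity and additivity say nothing about its
  \<open>zero\<close> field, which is therefore fixed explicitly.\<close>

definition lie_epi :: "(real, 'a) module \<Rightarrow> (real, 'b) module \<Rightarrow> ('a \<Rightarrow> 'b) \<Rightarrow> bool" where
  "lie_epi L L' f \<longleftrightarrow>
     f ` carrier L = carrier L' \<and> f \<zero>\<^bsub>L\<^esub> = \<zero>\<^bsub>L'\<^esub> \<and>
     (\<forall>x\<in>carrier L. \<forall>y\<in>carrier L. f (x \<oplus>\<^bsub>L\<^esub> y) = f x \<oplus>\<^bsub>L'\<^esub> f y) \<and>
     (\<forall>a. \<forall>x\<in>carrier L. f (a \<odot>\<^bsub>L\<^esub> x) = a \<odot>\<^bsub>L'\<^esub> f x) \<and>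
     (\<forall>x\<in>carrier L. \<forall>y\<in>carrier L. f (x \<otimes>\<^bsub>L\<^esub> y) = f x \<otimes>\<^bsub>L'\<^esub> f y)"

text \<open>Every element of \<open>L'\<close> is some \<open>f x\<close>, and operations on such
  elements can be moved under \<open>f\<close>, so each law of \<open>L'\<close> is the image of a
  law of \<open>L\<close>. This serves both the quotient by the ideal and the galilean
  algebra.\<close>

lemma lie_algebra_epi_image:
  assumes "lie_algebra L" and f: "lie_epi L L' f"
  shows "lie_algebra L'"
proof -
  interpret L: lie_algebra L by fact
  have carrier: "carrier L' = f ` carrier L" and zero: "\<zero>\<^bsub>L'\<^esub> = f \<zero>\<^bsub>L\<^esub>"
    using f by (auto simp: lie_epi_def)
  have ops [simp]:
    "\<And>x y. \<lbrakk>x \<in> carrier L; y \<in> carrier L\<rbrakk> \<Longrightarrow> f x \<oplus>\<^bsub>L'\<^esub> f y = f (x \<oplus>\<^bsub>L\<^esub> y)"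
    "\<And>a x. x \<in> carrier L \<Longrightarrow> a \<odot>\<^bsub>L'\<^esub> f x = f (a \<odot>\<^bsub>L\<^esub> x)"
    "\<And>x y. \<lbrakk>x \<in> carrier L; y \<in> carrier L\<rbrakk> \<Longrightarrow> f x \<otimes>\<^bsub>L'\<^esub> f y = f (x \<otimes>\<^bsub>L\<^esub> y)"
    using f by (auto simp: lie_epi_def)
  have smult [simp]: "a \<odot>\<^bsub>L\<^esub> x \<in> carrier L" if "x \<in> carrier L" for a x
    using L.smult_closed[of a x] that by simp
  note [simp] = L.bracket_closed
  have smult_rules:
    "\<And>a b x. x \<in> carrier L \<Longrightarrow> (a + b) \<odot>\<^bsub>L\<^esub> x = a \<odot>\<^bsub>L\<^esub> x \<oplus>\<^bsub>L\<^esub> b \<odot>\<^bsub>L\<^esub> x"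
    "\<And>a b x. x \<in> carrier L \<Longrightarrow> (a * b) \<odot>\<^bsub>L\<^esub> x = a \<odot>\<^bsub>L\<^esub> (b \<odot>\<^bsub>L\<^esub> x)"
    "\<And>x. x \<in> carrier L \<Longrightarrow> 1 \<odot>\<^bsub>L\<^esub> x = x"
    "\<And>a x y. \<lbrakk>x \<in> carrier L; y \<in> carrier L\<rbrakk> \<Longrightarrow>
      a \<odot>\<^bsub>L\<^esub> (x \<oplus>\<^bsub>L\<^esub> y) = a \<odot>\<^bsub>L\<^esub> x \<oplus>\<^bsub>L\<^esub> a \<odot>\<^bsub>L\<^esub> y"
    using L.smult_l_distr L.smult_assoc1 L.smult_one L.smult_r_distr by simp_all
  have "abelian_group L'"
  proof (rule abelian_groupI)
    fix x assume "x \<in> carrier L'"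
    then obtain x' where "x = f x'" "x' \<in> carrier L" by (auto simp: carrier)
    then show "\<exists>y\<in>carrier L'. y \<oplus>\<^bsub>L'\<^esub> x = \<zero>\<^bsub>L'\<^esub>"
      by (intro bexI[of _ "f (\<ominus>\<^bsub>L\<^esub> x')"]) (auto simp: carrier zero L.l_neg)
  qed (auto simp: carrier zero L.a_assoc L.a_comm L.a_lcomm)
  then have "Module.module real_ring L'"
    by (intro moduleI cring_real_ring) (auto simp: carrier smult_rules)
  then show ?thesis
    by (intro lie_algebra.intro lie_algebra_axioms.intro)
      (auto simp: carrier zero L.bracket_add_left L.bracket_add_right L.bracket_smult_left
        L.bracket_smult_right L.bracket_self L.jacobi)
qed

lemma klein_pair_epi_image:
  assumes "klein_pair L h" and f: "lie_epi L L' f"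
  shows "klein_pair L' (f ` h)"
proof -
  have L: "lie_algebra L" and h: "lie_subalgebra h L"
    using assms by (auto simp: klein_pair_def)
  have L': "lie_algebra L'"
    using L f by (rule lie_algebra_epi_image)
  note mods = L[THEN lie_algebra.axioms(1)] L'[THEN lie_algebra.axioms(1)]
  have sub: "h \<subseteq> carrier L" and h': "\<zero>\<^bsub>L\<^esub> \<in> h" "\<forall>x\<in>h. \<forall>y\<in>h. x \<oplus>\<^bsub>L\<^esub> y \<in> h"
    "\<forall>a. \<forall>x\<in>h. a \<odot>\<^bsub>L\<^esub> x \<in> h" "\<forall>x\<in>h. \<forall>y\<in>h. x \<otimes>\<^bsub>L\<^esub> y \<in> h"
    using h mods by (auto simp: lie_subalgebra_def submodule_real_iff)
  have f': "f ` carrier L = carrier L'" "f \<zero>\<^bsub>L\<^esub> = \<zero>\<^bsub>L'\<^esub>"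
    "\<And>x y. \<lbrakk>x \<in> h; y \<in> h\<rbrakk> \<Longrightarrow> f x \<oplus>\<^bsub>L'\<^esub> f y = f (x \<oplus>\<^bsub>L\<^esub> y)"
    "\<And>a x. x \<in> h \<Longrightarrow> a \<odot>\<^bsub>L'\<^esub> f x = f (a \<odot>\<^bsub>L\<^esub> x)"
    "\<And>x y. \<lbrakk>x \<in> h; y \<in> h\<rbrakk> \<Longrightarrow> f x \<otimes>\<^bsub>L'\<^esub> f y = f (x \<otimes>\<^bsub>L\<^esub> y)"
    using f sub unfolding lie_epi_def by (auto simp: subset_iff)
  have "f ` h \<subseteq> carrier L'" "\<zero>\<^bsub>L'\<^esub> \<in> f ` h"
    using sub h'(1) f'(1,2) by (blast, metis imageI)
  moreover have "\<forall>x\<in>f ` h. \<forall>y\<in>f ` h. x \<oplus>\<^bsub>L'\<^esub> y \<in> f ` h"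
    "\<forall>a. \<forall>x\<in>f ` h. a \<odot>\<^bsub>L'\<^esub> x \<in> f ` h" "\<forall>x\<in>f ` h. \<forall>y\<in>f ` h. x \<otimes>\<^bsub>L'\<^esub> y \<in> f ` h"
    using h' f'(3-5) by simp_all
  ultimately show ?thesis
    using L' mods by (simp add: klein_pair_def lie_subalgebra_def submodule_real_iff)
qed

text \<open>An element of an ideal inside \<open>h\<close> has all its brackets in \<open>h\<close>,
  so it suffices to exclude non-zero elements with this one-step property. The test is sufficient
  only: in general such elements need not form an ideal.\<close>

lemma effective_klein_pairI:
  assumes "klein_pair L h"
    and "\<And>x. \<lbrakk>x \<in> h; \<And>y. y \<in> carrier L \<Longrightarrow> y \<otimes>\<^bsub>L\<^esub> x \<in> h\<rbrakk> \<Longrightarrow> x = \<zero>\<^bsub>L\<^esub>"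
  shows "effective_klein_pair L h"
proof -
  have L: "Module.module real_ring L"
    using assms(1) by (simp add: klein_pair_def lie_algebra.axioms(1))
  show ?thesis
    unfolding effective_klein_pair_def
  proof (intro conjI allI impI assms(1))
    fix a assume "lie_ideal a L \<and> a \<subseteq> h"
    then have "\<zero>\<^bsub>L\<^esub> \<in> a" "\<And>x y. \<lbrakk>y \<in> carrier L; x \<in> a\<rbrakk> \<Longrightarrow> y \<otimes>\<^bsub>L\<^esub> x \<in> a" "a \<subseteq> h"
      by (simp_all add: lie_ideal_def submodule_real_iff[OF L])
    with assms(2) show "a = {\<zero>\<^bsub>L\<^esub>}"
      by (metis (no_types, lifting) empty_iff subset_iff subset_singleton_iff singletonI)
  qed
qed


section \<open>Lie algebras carried by subspaces\<close>

lemma lie_on_simps [simp]: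
  "carrier (lie_on V br) = V" "mult (lie_on V br) = br" "zero (lie_on V br) = 0"
  "add (lie_on V br) = (+)" "smult (lie_on V br) = (*\<^sub>R)"
  by (simp_all add: lie_on_def)

lemma module_lie_on:
  assumes "subspace V"
  shows "Module.module real_ring (lie_on V br)"
proof (rule moduleI)
  show "abelian_group (lie_on V br)"
  proof (rule abelian_groupI)
    fix x assume "x \<in> carrier (lie_on V br)"
    then show "\<exists>y\<in>carrier (lie_on V br). y \<oplus>\<^bsub>lie_on V br\<^esub> x = \<zero>\<^bsub>lie_on V br\<^esub>"
      using assms by (intro bexI[of _ "- x"]) (simp_all add: subspace_neg)
  qed (use assms in \<open>simp_all add: subspace_0 subspace_add\<close>)
qed (use assms in \<open>auto simp: cring_real_ring subspace_scale algebra_simps\<close>)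

lemma submodule_lie_on:
  "subspace V \<Longrightarrow> submodule N real_ring (lie_on V br) \<longleftrightarrow> subspace N \<and> N \<subseteq> V"
  by (auto simp: submodule_real_iff module_lie_on subspace_def)

lemma lie_algebra_lie_on:
  assumes "subspace V" "bilinear br"
    and "\<And>x y. \<lbrakk>x \<in> V; y \<in> V\<rbrakk> \<Longrightarrow> br x y \<in> V"
    and "\<And>x. x \<in> V \<Longrightarrow> br x x = 0"
    and "\<And>x y z. \<lbrakk>x \<in> V; y \<in> V; z \<in> V\<rbrakk> \<Longrightarrow> br x (br y z) + br y (br z x) + br z (br x y) = 0"
  shows "lie_algebra (lie_on V br)"
  using assms
  by (intro lie_algebra.intro lie_algebra_axioms.intro module_lie_on)
    (auto simp: bilinear_ladd bilinear_radd bilinear_lmul bilinear_rmul)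

text \<open>
  The cosets of the kernel of a linear map are its non-empty fibres, so the vector space
  operations on the quotient are those of the image, transported by the map \<open>fibre\<close>.
\<close>

locale linear_fibration =
  fixes V :: "'a::real_vector set" and f :: "'a \<Rightarrow> 'b::real_vector"
  assumes subspace: "subspace V" and linear: "linear f"
begin

definition fibre :: "'b \<Rightarrow> 'a set" where
  "fibre w = {x \<in> V. f x = w}"

lemma subspace_fibre_0: "Real_Vector_Spaces.subspace (fibre 0)"
  using subspace linear_subspace_kernel[OF linear]
  by (auto simp: fibre_def Real_Vector_Spaces.subspace_def)

lemma coset_eq_fibre:
  assumes "x \<in> V"
  shows "fibre 0 +>\<^bsub>lie_on V br\<^esub> x = fibre (f x)"
proof -
  have "y \<in> (\<lambda>n. n + x) ` fibre 0" if "y \<in> fibre (f x)" for y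
    using that assms
    by (intro image_eqI[of _ _ "y - x"])
      (auto simp: fibre_def linear_diff[OF linear] subspace_diff[OF subspace])
  moreover have "n + x \<in> fibre (f x)" if "n \<in> fibre 0" for n
    using that assms by (auto simp: fibre_def linear_add[OF linear] subspace_add[OF subspace])
  ultimately have "(\<lambda>n. n + x) ` fibre 0 = fibre (f x)"
    by blast
  then show ?thesis
    by (auto simp: a_r_coset_def')
qed

text \<open>The fibre over a point of the image has an element, whose value under \<open>f\<close>
  recovers the point. If \<open>w'\<close> lies outside the image, its fibre is empty and hence
  different.\<close>

lemma fibre_inject:
  assumes "w \<in> f ` V"
  shows "fibre w = fibre w' \<longleftrightarrow> w = w'"
  using assms by (auto simp: fibre_def)

lemma quotient_carrier: "carrier (lie_quotient (lie_on V br) (fibre 0)) = fibre ` f ` V"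
  by (auto simp: lie_quotient_def A_RCOSETS_def' coset_eq_fibre)

lemma quotient_zero: "\<zero>\<^bsub>lie_quotient (lie_on V br) (fibre 0)\<^esub> = fibre 0"
  by (simp add: lie_quotient_def)

lemma quotient_add:
  assumes "w \<in> f ` V" "w' \<in> f ` V"
  shows "fibre w \<oplus>\<^bsub>lie_quotient (lie_on V br) (fibre 0)\<^esub> fibre w' = fibre (w + w')"
proof -
  from assms obtain x where x: "x \<in> V" "f x = w"
    by blast
  have "\<exists>u\<in>fibre w. \<exists>v\<in>fibre w'. y = u + v" if "y \<in> fibre (w + w')" for y
    using that x
    by (intro bexI[of _ x] bexI[of _ "y - x"])
      (auto simp: fibre_def linear_diff[OF linear] subspace_diff[OF subspace])
  moreover have "u + v \<in> fibre (w + w')" if "u \<in> fibre w" "v \<in> fibre w'" for u v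
    using that by (auto simp: fibre_def linear_add[OF linear] subspace_add[OF subspace])
  ultimately show ?thesis
    by (auto simp: lie_quotient_def set_add_def')
qed

text \<open>The quotient operation is a union over representatives. All its members are one and the
  same fibre and there is at least one representative, so the union is that fibre. The action and
  the bracket below collapse in the same way.\<close>

lemma quotient_smult:
  assumes "w \<in> f ` V"
  shows "a \<odot>\<^bsub>lie_quotient (lie_on V br) (fibre 0)\<^esub> fibre w = fibre (a *\<^sub>R w)"
proof -
  have "fibre 0 +>\<^bsub>lie_on V br\<^esub> (a *\<^sub>R x) = fibre (a *\<^sub>R w)" if "x \<in> fibre w" for x
    using that coset_eq_fibre[of "a *\<^sub>R x"]
    by (auto simp: fibre_def linear_scale[OF linear] subspace_scale[OF subspace])
  moreover have "fibre w \<noteq> {}"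
    using assms by (auto simp: fibre_def)
  ultimately show ?thesis
    by (auto simp: lie_quotient_def)
qed

text \<open>The second assumption expresses that ad of \<open>x\<close> descends at
  \<open>w\<close>: modulo the kernel, the bracket depends only on the class of \<open>y\<close>.
  The kernel need not be an ideal, which is the situation of g/h.\<close>

lemma quotient_ad_fibre:
  assumes "w \<in> f ` V"
    and "\<And>y. \<lbrakk>y \<in> V; f y = w\<rbrakk> \<Longrightarrow> br x y \<in> V \<and> f (br x y) = w'"
  shows "quotient_ad (lie_on V br) (fibre 0) x (fibre w) = fibre w'"
proof -
  have "fibre 0 +>\<^bsub>lie_on V br\<^esub> br x y = fibre w'" if "y \<in> fibre w" for y
    using that assms(2)[of y] coset_eq_fibre[of "br x y"] by (auto simp: fibre_def)
  moreover have "fibre w \<noteq> {}"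
    using assms(1) by (auto simp: fibre_def)
  ultimately show ?thesis
    by (auto simp: quotient_ad_def)
qed

end

text \<open>Here the linear map also intertwines two brackets. When \<open>br\<close> makes
  \<open>V\<close> a Lie algebra, its laws pass to \<open>br'\<close> on the image through
  \<open>lie_epi_image\<close>.\<close>

locale lie_fibration = linear_fibration V f
  for V :: "'a::real_vector set" and f :: "'a \<Rightarrow> 'b::real_vector" +
  fixes br :: "'a \<Rightarrow> 'a \<Rightarrow> 'a" and br' :: "'b \<Rightarrow> 'b \<Rightarrow> 'b"
  assumes closed: "\<And>x y. \<lbrakk>x \<in> V; y \<in> V\<rbrakk> \<Longrightarrow> br x y \<in> V"
    and hom: "\<And>x y. \<lbrakk>x \<in> V; y \<in> V\<rbrakk> \<Longrightarrow> f (br x y) = br' (f x) (f y)"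
begin

lemma image_bracket_closed:
  assumes "w \<in> f ` V" "w' \<in> f ` V"
  shows "br' w w' \<in> f ` V"
  using assms closed by (auto simp flip: hom)

lemma quotient_mult:
  assumes "w \<in> f ` V" "w' \<in> f ` V"
  shows "fibre w \<otimes>\<^bsub>lie_quotient (lie_on V br) (fibre 0)\<^esub> fibre w' = fibre (br' w w')"
proof -
  have "fibre 0 +>\<^bsub>lie_on V br\<^esub> br x y = fibre (br' w w')" if "x \<in> fibre w" "y \<in> fibre w'" for x y
    using that coset_eq_fibre[of "br x y"] by (auto simp: fibre_def closed hom)
  moreover have "fibre w \<noteq> {}" "fibre w' \<noteq> {}"
    using assms by (auto simp: fibre_def)
  ultimately show ?thesis
    by (auto simp: lie_quotient_def rcoset_mult_def)
qed

lemma lie_epi_image: "lie_epi (lie_on V br) (lie_on (f ` V) br') f"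
  by (auto simp: lie_epi_def hom linear_0[OF linear] linear_add[OF linear] linear_scale[OF linear])

text \<open>On \<open>V\<close> the coset projection is \<open>fibre\<close> after \<open>f\<close>.
  Through it the quotient receives its Klein pair structure from
  \<open>klein_pair_epi_image\<close>.\<close>

lemma lie_epi_coset:
  "lie_epi (lie_on V br) (lie_quotient (lie_on V br) (fibre 0))
     (\<lambda>x. fibre 0 +>\<^bsub>lie_on V br\<^esub> x)"
proof -
  have "(\<lambda>x. fibre 0 +>\<^bsub>lie_on V br\<^esub> x) ` V = fibre ` f ` V"
    unfolding image_image by (rule image_cong) (simp_all add: coset_eq_fibre)
  then show ?thesis
    using subspace
    by (simp add: lie_epi_def quotient_carrier quotient_zero coset_eq_fibre closed hom subspace_0
        subspace_add subspace_scale quotient_add quotient_smult quotient_mult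
        linear_0[OF linear] linear_add[OF linear] linear_scale[OF linear])
qed

text \<open>The first isomorphism theorem for Klein pairs: the map induced by \<open>f\<close> on
  cosets is inverse to \<open>fibre\<close>.\<close>

lemma klein_pairs_isomorphic_image:
  assumes h: "h \<subseteq> V"
  shows "klein_pairs_isomorphic (lie_quotient (lie_on V br) (fibre 0))
    (quotient_subalgebra (lie_on V br) h (fibre 0)) (lie_on (f ` V) br') (f ` h)"
proof -
  \<comment> \<open>\<open>f\<close> is constant on a coset, so the image of the coset is a
    singleton, and its element is the value of the induced map.\<close>
  let ?g = "\<lambda>S. the_elem (f ` S)"
  have g: "?g (fibre w) = w" if "w \<in> f ` V" for w
  proof -
    have "f ` fibre w = {w}"
      using that by (auto simp: fibre_def)
    then show ?thesis by simp
  qed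
  have closed_image: "u + v \<in> f ` V" "a *\<^sub>R u \<in> f ` V" "br' u v \<in> f ` V"
    if "u \<in> f ` V" "v \<in> f ` V" for u v a
    using that linear_subspace_image[OF linear subspace] image_bracket_closed
    by (simp_all add: subspace_add subspace_scale)
  have "bij_betw ?g (fibre ` f ` V) (f ` V)"
    by (rule bij_betw_byWitness[where f' = fibre]) (auto simp: g)
  then have "lie_iso (lie_quotient (lie_on V br) (fibre 0)) (lie_on (f ` V) br') ?g"
    by (auto simp: lie_iso_def quotient_carrier quotient_add quotient_smult quotient_mult g
        closed_image)
  moreover have "?g ` quotient_subalgebra (lie_on V br) h (fibre 0) = f ` h"
  proof -
    have "?g (fibre 0 +>\<^bsub>lie_on V br\<^esub> x) = f x" if "x \<in> h" for x
      using that h by (simp add: coset_eq_fibre g subset_iff)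
    then show ?thesis
      unfolding quotient_subalgebra_def image_image by (rule image_cong[OF refl])
  qed
  ultimately show ?thesis
    unfolding klein_pairs_isomorphic_def by blast
qed

end


section \<open>The ambient algebra\<close>

lemma subspace_so_mat: "subspace (so_mat :: (real^'n::finite^'n) set)"
proof -
  have lin: "linear (\<lambda>A :: real^'n^'n. transpose A + A)"
    by (rule linearI) (simp_all add: transpose_def vec_eq_iff algebra_simps)
  have "so_mat = {A :: real^'n^'n. transpose A + A = 0}"
    by (simp add: so_mat_def eq_neg_iff_add_eq_0)
  with linear_subspace_kernel[OF lin] show ?thesis
    by simp
qed

text \<open>This infinitesimal invariance of the inner product makes [D,K] = C and [D,P] = M
  compatible with J, and \<gamma> invariant.\<close>

lemma so_mat_inner:
  assumes "A \<in> so_mat"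
  shows "(A *v x) \<bullet> y = - (x \<bullet> (A *v y))"
proof -
  have "x \<bullet> (A *v y) = (transpose A *v x) \<bullet> y"
    by (simp add: dot_lmul_matrix)
  also have "\<dots> = - ((A *v x) \<bullet> y)"
    using assms matrix_vector_mult_diff_rdistrib[of 0 A x] by (simp add: so_mat_def)
  finally show ?thesis by simp
qed

lemma so_mat_commutator:
  assumes "A \<in> so_mat" "B \<in> so_mat"
  shows "A ** B - B ** A \<in> so_mat"
proof -
  have "transpose (A ** B - B ** A) = transpose (A ** B) - transpose (B ** A)"
    by (simp add: transpose_def vec_eq_iff)
  also have "\<dots> = transpose B ** transpose A - transpose A ** transpose B"
    by (simp add: matrix_transpose_mul)
  also have "\<dots> = - (A ** B - B ** A)"
    using assms
    by (simp add: so_mat_def matrix_mult_bilinear(3)[of 0, simplified]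
        matrix_mult_bilinear(4)[of _ 0, simplified])
  finally show ?thesis by (simp add: so_mat_def)
qed

section \<open>The ambient bracket and its Jacobi identity\<close>

definition amb_space :: "'n::finite amb set" where
  "amb_space = {(m, t, c, p, d, k, A). A \<in> so_mat}"

lemma amb_algebra_eq: "amb_algebra r \<epsilon> \<omega> = lie_on amb_space (amb_bracket r \<epsilon> \<omega>)"
  by (simp add: amb_algebra_def amb_space_def)

lemma subspace_amb_space: "subspace amb_space"
  by (rule subspaceI)
    (auto simp: amb_space_def zero_prod_def subspace_so_mat subspace_0 subspace_add subspace_scale)

lemma amb_bracket_closed:
  "\<lbrakk>x \<in> amb_space; y \<in> amb_space\<rbrakk> \<Longrightarrow> amb_bracket r \<epsilon> \<omega> x y \<in> amb_space"
  by (auto simp: amb_space_def so_mat_commutator)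

text \<open>The identity is checked by components. Inner products occur only in those of M and C,
  goals 1 and 3, and only there is skew-symmetry used; the others are identities of matrix
  algebra.\<close>

lemma amb_jacobi:
  fixes x y z :: "'n::finite amb"
  assumes "x \<in> amb_space" "y \<in> amb_space" "z \<in> amb_space"
  shows "amb_bracket r \<epsilon> \<omega> x (amb_bracket r \<epsilon> \<omega> y z) + amb_bracket r \<epsilon> \<omega> y (amb_bracket r \<epsilon> \<omega> z x)
    + amb_bracket r \<epsilon> \<omega> z (amb_bracket r \<epsilon> \<omega> x y) = 0"
proof -
  obtain m t c p d k A m' t' c' p' d' k' A' m'' t'' c'' p'' d'' k'' A''
    where xyz: "x = (m, t, c, p, d, k, A)" "y = (m', t', c', p', d', k', A')"
      "z = (m'', t'', c'', p'', d'', k'', A'')"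
    by (metis prod.exhaust)
  have so: "A \<in> so_mat" "A' \<in> so_mat" "A'' \<in> so_mat"
    using assms by (auto simp: amb_space_def xyz)
  \<comment> \<open>As an unrestricted rewrite rule this swap would undo itself. Below, one argument
    is fixed to a P component (for goal 3, a K component), which gives it a direction.\<close>
  have skew: "v \<bullet> (B *v u) = - (u \<bullet> (B *v v))" if "B \<in> so_mat" for B :: "real^'n^'n" and u v
    using so_mat_inner[OF that, of u v] by (simp add: inner_commute)
  note skew_so = skew[OF so(1)] skew[OF so(2)] skew[OF so(3)]
  show ?thesis
    unfolding xyz amb_bracket.simps zero_prod_def add_Pair prod.inject
  proof (intro conjI, goal_cases)
    case 1
    then show ?case
      by (simp add: inner_add_left inner_add_right inner_diff_left inner_diff_right algebra_simps
          inner_commute so_mat_inner[OF so(1)] so_mat_inner[OF so(2)] so_mat_inner[OF so(3)]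
          skew_so[of p] skew_so[of p'] skew_so[of p''])
  next
    case 3
    then show ?case
      by (simp add: inner_add_left inner_add_right inner_diff_left inner_diff_right algebra_simps
          inner_commute so_mat_inner[OF so(1)] so_mat_inner[OF so(2)] so_mat_inner[OF so(3)]
          skew_so[of k] skew_so[of k'] skew_so[of k''])
  qed (simp_all add: algebra_simps matrix_mult_bilinear matrix_mul_assoc
      matrix_vector_mult_diff_rdistrib matrix_vector_mul_assoc matrix_vector_mult_scaleR)
qed

lemma lie_algebra_amb: "lie_algebra (amb_algebra r \<epsilon> \<omega>)"
  unfolding amb_algebra_eq
proof (rule lie_algebra_lie_on)
  show "amb_bracket r \<epsilon> \<omega> x x = 0" for x
    by (cases x) (simp add: zero_prod_def)
qed (simp_all add: subspace_amb_space bilinear_amb_bracket amb_bracket_closed amb_jacobi)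

section \<open>The projections modelling g/i and g/h\<close>

fun kin_part :: "'n::finite amb \<Rightarrow> 'n kin" where
  "kin_part (m, t, c, p, d, k, A) = (t, p, k, A)"

fun tangent_part :: "'n::finite amb \<Rightarrow> real \<times> real \<times> (real^'n)" where
  "tangent_part (m, t, c, p, d, k, A) = (m, t, p)"

text \<open>The H, P, K, J components of a bracket involve only the same components of the
  arguments, and r enters only those of M, C and D.\<close>

lemma kin_part_bracket:
  "kin_part (amb_bracket r \<epsilon> \<omega> x y) = gal_bracket \<epsilon> \<omega> (kin_part x) (kin_part y)"
  by (cases x; cases y) simp

interpretation kin: lie_fibration amb_space kin_part "amb_bracket r \<epsilon> \<omega>" "gal_bracket \<epsilon> \<omega>"
  for r \<epsilon> \<omega>
  by unfold_locales
    (auto simp: subspace_amb_space amb_bracket_closed kin_part_bracket intro!: linearI)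

text \<open>Only the linear structure descends: \<open>amb_CDKJ\<close> is not an ideal, since [K,H]
  = P.\<close>

interpretation tangent: linear_fibration amb_space tangent_part
  by unfold_locales (auto simp: subspace_amb_space intro!: linearI)

lemma amb_MCD_eq: "amb_MCD = kin.fibre 0"
  unfolding kin.fibre_def
  by (auto simp: amb_MCD_def amb_space_def zero_prod_def subspace_0[OF subspace_so_mat])

lemma amb_CDKJ_eq: "amb_CDKJ = tangent.fibre 0"
  unfolding tangent.fibre_def by (auto simp: amb_CDKJ_def amb_space_def zero_prod_def)

lemma amb_CDKJ_subset: "amb_CDKJ \<subseteq> amb_space"
  by (auto simp: amb_CDKJ_def amb_space_def)

lemma klein_pair_amb: "klein_pair (amb_algebra r \<epsilon> \<omega>) (amb_CDKJ :: 'n::finite amb set)"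
proof -
  have "subspace (amb_CDKJ :: 'n amb set)"
    unfolding amb_CDKJ_eq by (rule tangent.subspace_fibre_0)
  moreover have "\<forall>x\<in>amb_CDKJ. \<forall>y\<in>amb_CDKJ. amb_bracket r \<epsilon> \<omega> x y \<in> amb_CDKJ"
    by (auto simp: amb_CDKJ_def so_mat_commutator)
  ultimately show ?thesis
    by (simp add: klein_pair_def lie_algebra_amb)
      (simp add: lie_subalgebra_def amb_algebra_eq submodule_lie_on subspace_amb_space
        amb_CDKJ_subset)
qed

lemma lie_ideal_amb_MCD: "lie_ideal (amb_MCD :: 'n::finite amb set) (amb_algebra r \<epsilon> \<omega>)"
proof -
  have "subspace (amb_MCD :: 'n amb set)"
    unfolding amb_MCD_eq by (rule kin.subspace_fibre_0)
  moreover have "amb_MCD \<subseteq> (amb_space :: 'n amb set)"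
    by (auto simp: amb_MCD_eq kin.fibre_def)
  moreover have "amb_bracket r \<epsilon> \<omega> x y \<in> amb_MCD" if "y \<in> amb_MCD" for x y :: "'n amb"
    using that by (cases x) (auto simp: amb_MCD_def)
  ultimately show ?thesis
    by (simp add: lie_ideal_def amb_algebra_eq submodule_lie_on subspace_amb_space)
qed

lemma kin_part_image_amb_space: "kin_part ` amb_space = {(t, p, k, A). A \<in> so_mat}"
proof -
  have "(t, p, k, A) \<in> kin_part ` amb_space" if "A \<in> so_mat" for t p k and A :: "real^'n^'n"
    using that by (intro image_eqI[of _ _ "(0, t, 0, p, 0, k, A)"]) (auto simp: amb_space_def)
  then show ?thesis by (auto simp: amb_space_def)
qed

lemma kin_part_image_amb_CDKJ: "kin_part ` amb_CDKJ = gal_KJ"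
proof -
  have "(0, 0, k, A) \<in> kin_part ` amb_CDKJ" if "A \<in> so_mat" for k and A :: "real^'n^'n"
    using that by (intro image_eqI[of _ _ "(0, 0, 0, 0, 0, k, A)"]) (auto simp: amb_CDKJ_def)
  then show ?thesis by (auto simp: amb_CDKJ_def gal_KJ_def)
qed

lemma gal_algebra_eq: "gal_algebra \<epsilon> \<omega> = lie_on (kin_part ` amb_space) (gal_bracket \<epsilon> \<omega>)"
  by (simp add: gal_algebra_def kin_part_image_amb_space)

text \<open>The galilean pair is the image of the ambient one under \<open>kin_part\<close> and
  inherits the Jacobi identity from it.\<close>

lemma klein_pair_gal: "klein_pair (gal_algebra \<epsilon> \<omega>) gal_KJ"
  using klein_pair_epi_image[OF klein_pair_amb[unfolded amb_algebra_eq]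
      kin.lie_epi_image]
  by (simp add: gal_algebra_eq kin_part_image_amb_CDKJ)

section \<open>Effectiveness of both pairs\<close>

lemma matrix_eq_zeroI:
  fixes A :: "real^'n::finite^'m::finite"
  assumes "\<And>v. A *v v = 0"
  shows "A = 0"
  using assms by (simp add: matrix_eq)

lemma effective_amb: "effective_klein_pair (amb_algebra r \<epsilon> \<omega>) amb_CDKJ"
proof (rule effective_klein_pairI[OF klein_pair_amb])
  fix x :: "'n::finite amb"
  assume x: "x \<in> amb_CDKJ"
    and br: "\<And>y. y \<in> carrier (amb_algebra r \<epsilon> \<omega>) \<Longrightarrow> y \<otimes>\<^bsub>amb_algebra r \<epsilon> \<omega>\<^esub> x \<in> amb_CDKJ"
  obtain c d k A where x_eq: "x = (0, 0, c, 0, d, k, A)"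
    using x by (auto simp: amb_CDKJ_def)
  have "amb_bracket r \<epsilon> \<omega> y x \<in> amb_CDKJ" if "y \<in> amb_space" for y
    using br[of y] that by (simp add: amb_algebra_eq)
  \<comment> \<open>Bracketing with H puts -c at M and -k at P; bracketing with the vector v in P
    puts the negatives of d \<bullet> v at M and of A v at P. All of these must vanish in
    \<open>amb_CDKJ\<close>.\<close>
  from this[of "(0, 1, 0, 0, 0, 0, 0)"] this[of "(0, 0, 0, v, 0, 0, 0)" for v]
  have "c = 0" "k = 0" and P: "\<And>v. d \<bullet> v = 0 \<and> A *v v = 0"
    by (auto simp: x_eq amb_space_def amb_CDKJ_def subspace_0[OF subspace_so_mat])
  moreover have "d = 0"
    using P[of d] by simp
  moreover have "A = 0"
    using P by (intro matrix_eq_zeroI) blast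
  ultimately show "x = \<zero>\<^bsub>amb_algebra r \<epsilon> \<omega>\<^esub>"
    by (simp add: x_eq amb_algebra_eq zero_prod_def)
qed

lemma effective_quotient_amb:
  "effective_klein_pair (lie_quotient (amb_algebra r \<epsilon> \<omega>) amb_MCD)
     (quotient_subalgebra (amb_algebra r \<epsilon> \<omega>) amb_CDKJ amb_MCD)"
  (is "effective_klein_pair ?Q ?h")
proof (rule effective_klein_pairI)
  show "klein_pair ?Q ?h"
    using klein_pair_epi_image[OF klein_pair_amb[unfolded amb_algebra_eq]
        kin.lie_epi_coset]
    by (simp add: quotient_subalgebra_def amb_algebra_eq amb_MCD_eq)
next
  fix S :: "'a::finite amb set"
  assume S: "S \<in> ?h" and br: "\<And>T. T \<in> carrier ?Q \<Longrightarrow> T \<otimes>\<^bsub>?Q\<^esub> S \<in> ?h"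
  have h: "?h = kin.fibre ` gal_KJ"
    unfolding quotient_subalgebra_def kin_part_image_amb_CDKJ[symmetric] image_image amb_MCD_eq
      amb_algebra_eq
    using amb_CDKJ_subset by (intro image_cong refl kin.coset_eq_fibre) blast
  obtain k A where S_eq: "S = kin.fibre (0, 0, k, A)" and A: "A \<in> so_mat"
    using S unfolding h by (auto simp: gal_KJ_def)
  \<comment> \<open>The condition on cosets only gives a fibre over some point of
    \<open>gal_KJ\<close>; injectivity of \<open>fibre\<close> on the image identifies that point
    with the galilean bracket.\<close>
  have "gal_bracket \<epsilon> \<omega> w (0, 0, k, A) \<in> gal_KJ" if w: "w \<in> kin_part ` amb_space" for w
  proof -
    have S': "(0, 0, k, A) \<in> kin_part ` amb_space"
      using A by (simp add: kin_part_image_amb_space)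
    have "kin.fibre (gal_bracket \<epsilon> \<omega> w (0, 0, k, A)) \<in> kin.fibre ` gal_KJ"
      using br[of "kin.fibre w"] w S'
      unfolding h by (simp add: S_eq amb_algebra_eq amb_MCD_eq kin.quotient_carrier
          kin.quotient_mult)
    then obtain w' where "w' \<in> gal_KJ"
      and eq: "kin.fibre (gal_bracket \<epsilon> \<omega> w (0, 0, k, A)) = kin.fibre w'"
      by (rule imageE)
    moreover have "gal_bracket \<epsilon> \<omega> w (0, 0, k, A) = w'"
      using eq kin.fibre_inject[OF kin.image_bracket_closed[OF w S']] by blast
    ultimately show ?thesis by simp
  qed
  \<comment> \<open>The P components of these brackets with H and with v are -k and the negative of
    A v.\<close>
  from this[of "(1, 0, 0, 0)"] this[of "(0, v, 0, 0)" for v]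
  have "k = 0" and P: "\<And>v. A *v v = 0"
    by (auto simp: kin_part_image_amb_space gal_KJ_def subspace_0[OF subspace_so_mat])
  moreover have "A = 0"
    using P by (rule matrix_eq_zeroI)
  ultimately have "S = kin.fibre 0"
    by (simp add: S_eq zero_prod_def)
  then show "S = \<zero>\<^bsub>?Q\<^esub>"
    by (simp add: amb_algebra_eq amb_MCD_eq kin.quotient_zero)
qed

lemma projectable_amb: "projectable_triplet (amb_algebra r \<epsilon> \<omega>) amb_CDKJ amb_MCD"
proof -
  \<comment> \<open>M shows that the ideal is non-zero, H that it is proper.\<close>
  have "gen_M \<in> amb_MCD" "gen_M \<noteq> 0" "gen_H \<in> amb_space" "gen_H \<notin> amb_MCD"
    by (simp_all add: gen_defs amb_MCD_def amb_space_def zero_prod_def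
        subspace_0[OF subspace_so_mat])
  then have "amb_MCD \<noteq> {0}" "amb_MCD \<noteq> amb_space"
    by blast+
  then show ?thesis
    unfolding projectable_triplet_def
    by (simp add: effective_amb lie_ideal_amb_MCD effective_quotient_amb)
      (simp add: amb_algebra_eq)
qed

lemma lifts_amb:
  "lifts_klein_pair (amb_algebra r \<epsilon> \<omega>) amb_CDKJ (amb_MCD :: 'n::finite amb set)
     (gal_algebra \<epsilon> \<omega>) (gal_KJ :: 'n kin set)"
proof -
  have "klein_pairs_isomorphic (lie_quotient (amb_algebra r \<epsilon> \<omega>) (amb_MCD :: 'n amb set))
      (quotient_subalgebra (amb_algebra r \<epsilon> \<omega>) amb_CDKJ amb_MCD) (gal_algebra \<epsilon> \<omega>)
      (gal_KJ :: 'n kin set)"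
    unfolding amb_algebra_eq amb_MCD_eq gal_algebra_eq kin_part_image_amb_CDKJ[symmetric]
    by (rule kin.klein_pairs_isomorphic_image[OF amb_CDKJ_subset])
  then show ?thesis
    by (simp add: lifts_klein_pair_def projectable_amb klein_pair_gal)
qed


section \<open>The leibnizian structure\<close>

lemma tangent_part_image: "tangent_part ` amb_space = UNIV"
proof -
  have "w \<in> tangent_part ` amb_space" for w :: "real \<times> real \<times> (real^'n)"
    by (cases w, rule image_eqI[of _ _ "(fst w, fst (snd w), 0, snd (snd w), 0, 0, 0)"])
      (auto simp: amb_space_def subspace_0[OF subspace_so_mat])
  then show ?thesis by blast
qed

lemma amb_coset_eq:
  "x \<in> amb_space \<Longrightarrow> amb_CDKJ +>\<^bsub>amb_algebra r \<epsilon> \<omega>\<^esub> x = tangent.fibre (tangent_part x)"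
  by (simp add: amb_algebra_eq amb_CDKJ_eq tangent.coset_eq_fibre)

lemma dual_tangent_fibre:
  "dual_H (tangent.fibre (m, t, p)) = t" "dual_P i (tangent.fibre (m, t, p)) = p $ i"
proof -
  let ?x = "(m, t, 0, p, 0, 0, 0)"
  \<comment> \<open>The parameters 0 0 0 are an arbitrary choice: cosets depend on addition
    alone.\<close>
  have "tangent.fibre (m, t, p) = amb_CDKJ +>\<^bsub>amb_algebra 0 0 0\<^esub> ?x"
    by (simp add: amb_coset_eq amb_space_def subspace_0[OF subspace_so_mat])
  then show "dual_H (tangent.fibre (m, t, p)) = t" "dual_P i (tangent.fibre (m, t, p)) = p $ i"
    by (simp_all add: dual_H_coset dual_P_coset)
qed

lemma leibnizian_amb:
  fixes r \<epsilon> \<omega> :: real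
  defines "g \<equiv> (amb_algebra r \<epsilon> \<omega> :: (real, 'n::finite amb) module)"
  shows "leibnizian g amb_CDKJ (amb_CDKJ +>\<^bsub>g\<^esub> gen_M) (\<lambda>S. - dual_H S)
    (\<lambda>S T. \<Sum>j\<in>UNIV. dual_P j S * dual_P j T)" (is "leibnizian g ?h ?\<xi> ?\<psi> ?\<gamma>")
proof -
  let ?F = "tangent.fibre :: _ \<Rightarrow> 'n amb set"
  define V where "V = lie_quotient g ?h"
  have V: "V = lie_quotient (lie_on amb_space (amb_bracket r \<epsilon> \<omega>)) (?F 0)"
    by (simp add: V_def g_def amb_algebra_eq amb_CDKJ_eq)
  have carrier: "carrier V = range ?F"
    unfolding V tangent.quotient_carrier by (simp add: tangent_part_image)
  have ops: "\<zero>\<^bsub>V\<^esub> = ?F 0" "?F w \<oplus>\<^bsub>V\<^esub> ?F w' = ?F (w + w')" "a \<odot>\<^bsub>V\<^esub> ?F w = ?F (a *\<^sub>R w)" for w w' a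
    unfolding V
    by (simp_all add: tangent.quotient_zero tangent.quotient_add tangent.quotient_smult
        tangent_part_image)
  have inj: "?F w = ?F w' \<longleftrightarrow> w = w'" for w w'
    by (rule tangent.fibre_inject) (simp add: tangent_part_image)
  have \<xi>: "?\<xi> = ?F (1, 0, 0)"
    by (simp add: g_def amb_coset_eq gen_defs amb_space_def subspace_0[OF subspace_so_mat])
  have \<gamma>: "?\<gamma> (?F (m, t, p)) (?F (m', t', p')) = p \<bullet> p'" for m t p m' t' p'
    by (simp add: dual_tangent_fibre inner_vec_def)
  have kernel: "form_kernel V ?\<psi> = {?F (m, 0, p) | m p. True}"
    by (auto simp: form_kernel_def carrier dual_tangent_fibre inj)
  \<comment> \<open>All invariance claims are read off from this formula: m does not enter, so \<xi>
    is annihilated; the H entry is 0, so \<psi> is invariant; and on the kernel, where t = 0, p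
    changes by the skew matrix A alone, so \<gamma> is invariant.\<close>
  have act: "quotient_ad g ?h (0, 0, c, 0, d, k, A) (?F (m, t, p)) =
      ?F (d \<bullet> p + c * t, 0, t *\<^sub>R k + A *v p)" if "A \<in> so_mat" for c d k A m t p
    unfolding g_def amb_algebra_eq amb_CDKJ_eq
    using that
    by (intro tangent.quotient_ad_fibre, simp add: tangent_part_image)
      (auto simp: amb_space_def so_mat_commutator)
  have h: "(\<forall>x\<in>?h. P x) \<longleftrightarrow> (\<forall>c d k A. A \<in> so_mat \<longrightarrow> P (0, 0, c, 0, d, k, A))"
    for P :: "'n amb \<Rightarrow> bool"
    by (auto simp: amb_CDKJ_def)
  have radical: "{u \<in> form_kernel V ?\<psi>. \<forall>v\<in>form_kernel V ?\<psi>. ?\<gamma> u v = 0} =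
      {a \<odot>\<^bsub>V\<^esub> ?\<xi> | a. True}"
  proof -
    have "p = 0" if "\<forall>v\<in>form_kernel V ?\<psi>. ?\<gamma> (?F (m, 0, p)) v = 0" for m p
    proof -
      \<comment> \<open>Pairing a radical element with itself gives p \<bullet> p = 0.\<close>
      have "?\<gamma> (?F (m, 0, p)) (?F (m, 0, p)) = 0"
        using that unfolding kernel by blast
      then show ?thesis by (simp only: \<gamma> inner_eq_zero_iff)
    qed
    moreover have "{a \<odot>\<^bsub>V\<^esub> ?\<xi> | a. True} = {?F (a, 0, 0) | a. True}"
      by (simp add: \<xi> ops)
    moreover have "?\<gamma> (?F (m, 0, 0)) v = 0" if "v \<in> form_kernel V ?\<psi>" for m v
      using that unfolding kernel by (auto simp: \<gamma>)
    ultimately show ?thesis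
      unfolding kernel by (auto simp: \<gamma>)
  qed
  have skew: "(A *v p) \<bullet> p' + p \<bullet> (A *v p') = 0" if "A \<in> so_mat" for A and p p' :: "real^'n"
    using so_mat_inner[OF that, of p p'] by simp
  have "klein_pair g ?h"
    unfolding g_def by (rule klein_pair_amb)
  moreover have "?\<xi> \<in> carrier V" "?\<xi> \<noteq> \<zero>\<^bsub>V\<^esub>" "?\<psi> ?\<xi> = 0"
    by (simp_all add: \<xi> carrier ops inj dual_tangent_fibre zero_prod_def)
  moreover have "\<forall>x\<in>?h. quotient_ad g ?h x ?\<xi> = \<zero>\<^bsub>V\<^esub>"
    unfolding h by (simp add: \<xi> ops act zero_prod_def)
  moreover have "linear_form_on V (carrier V) ?\<psi>"
    by (auto simp: linear_form_on_def carrier ops dual_tangent_fibre)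
  moreover have "\<exists>u\<in>carrier V. ?\<psi> u \<noteq> 0"
    by (rule bexI[of _ "?F (0, 1, 0)"]) (simp_all add: carrier dual_tangent_fibre)
  moreover have "\<forall>x\<in>?h. \<forall>u\<in>carrier V. ?\<psi> (quotient_ad g ?h x u) = 0"
    unfolding h by (auto simp: carrier act dual_tangent_fibre)
  moreover have "\<forall>u\<in>form_kernel V ?\<psi>. linear_form_on V (form_kernel V ?\<psi>) (?\<gamma> u)"
    unfolding kernel linear_form_on_def by (auto simp: ops \<gamma> inner_add_right)
  moreover have "\<forall>u\<in>form_kernel V ?\<psi>. \<forall>v\<in>form_kernel V ?\<psi>. ?\<gamma> u v = ?\<gamma> v u"
    by (simp add: mult.commute)
  moreover have "\<forall>u\<in>form_kernel V ?\<psi>. ?\<gamma> u u \<ge> 0"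
    by (simp add: sum_nonneg)
  moreover have "\<forall>x\<in>?h. \<forall>u\<in>form_kernel V ?\<psi>. \<forall>v\<in>form_kernel V ?\<psi>.
      ?\<gamma> (quotient_ad g ?h x u) v + ?\<gamma> u (quotient_ad g ?h x v) = 0"
    unfolding h kernel by (auto simp: act \<gamma> skew)
  ultimately show ?thesis
    using radical unfolding leibnizian_def Let_def V_def by (intro conjI)
qed


section \<open>Reductivity\<close>

text \<open>The brackets of h with the complement have r as a factor in their C and D components,
  coming from [C,H] and [D,H]. For r = 0 only [C,H] = M, [K,H] = P, [D,P] = M and the rotations of P
  remain.\<close>

lemma reductive_amb:
  "reductive_klein_pair (amb_algebra 0 \<epsilon> \<omega>) (amb_CDKJ :: 'n::finite amb set)"
proof -
  define p where "p = {(m, t, c, p, d, k, A :: real^'n^'n).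
    c = (0 :: real) \<and> d = (0 :: real^'n) \<and> k = (0 :: real^'n) \<and> A = 0} \<inter> amb_space"
  have p_iff: "(m, t, c, v, d, k, A) \<in> p \<longleftrightarrow> c = 0 \<and> d = 0 \<and> k = 0 \<and> A = 0" for m t c v d k A
    by (auto simp: p_def amb_space_def subspace_0[OF subspace_so_mat])
  have "subspace p"
    by (rule subspaceI) (auto simp: p_iff zero_prod_def split: prod.splits)
  moreover have "p \<subseteq> amb_space"
    by (simp add: p_def)
  moreover have "amb_CDKJ \<inter> p = {0}"
    by (auto simp: p_iff amb_CDKJ_def zero_prod_def subspace_0[OF subspace_so_mat])
  moreover have "\<exists>x\<in>amb_CDKJ. \<exists>y\<in>p. z = x + y" if "z \<in> amb_space" for z
  proof -
    obtain m t c v d k A where z: "z = (m, t, c, v, d, k, A)"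
      by (metis prod.exhaust)
    with that show ?thesis
      by (intro bexI[of _ "(0, 0, c, 0, d, k, A)"] bexI[of _ "(m, t, 0, v, 0, 0, 0)"])
        (auto simp: p_iff amb_CDKJ_def amb_space_def)
  qed
  moreover have "x + y \<in> amb_space" if "x \<in> amb_CDKJ" "y \<in> p" for x y
    using that amb_CDKJ_subset by (auto simp: p_def intro: subspace_add[OF subspace_amb_space])
  moreover have "\<forall>x\<in>amb_CDKJ. \<forall>y\<in>p. amb_bracket 0 \<epsilon> \<omega> x y \<in> p"
    by (auto simp: p_iff amb_CDKJ_def)
  ultimately show ?thesis
    using klein_pair_amb[of 0 \<epsilon> \<omega>]
    unfolding reductive_klein_pair_def
    by (intro conjI exI[of _ p])
      (auto simp: amb_algebra_eq submodule_lie_on subspace_amb_space set_add_def')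
qed

lemma not_reductive_amb:
  assumes "r \<noteq> 0"
  shows "\<not> reductive_klein_pair (amb_algebra r \<epsilon> \<omega> :: (real, 'n::finite amb) module) amb_CDKJ"
proof
  assume "reductive_klein_pair (amb_algebra r \<epsilon> \<omega> :: (real, 'n amb) module) amb_CDKJ"
  then obtain p :: "'n amb set" where int: "amb_CDKJ \<inter> p = {0}"
    and sum: "amb_CDKJ <+>\<^bsub>lie_on amb_space (amb_bracket r \<epsilon> \<omega>)\<^esub> p = amb_space"
    and inv: "\<And>x y. \<lbrakk>x \<in> amb_CDKJ; y \<in> p\<rbrakk> \<Longrightarrow> amb_bracket r \<epsilon> \<omega> x y \<in> p"
    unfolding reductive_klein_pair_def amb_algebra_eq lie_on_simps by blast
  have "gen_H \<in> amb_CDKJ <+>\<^bsub>lie_on amb_space (amb_bracket r \<epsilon> \<omega>)\<^esub> p"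
    unfolding sum by (simp add: gen_defs amb_space_def subspace_0[OF subspace_so_mat])
  then obtain x y where x: "x \<in> amb_CDKJ" and y: "y \<in> p" and "gen_H = x + y"
    by (auto simp: set_add_def')
  from x obtain c d k A where x_eq: "x = (0, 0, c, 0, d, k, A)" and "A \<in> so_mat"
    by (auto simp: amb_CDKJ_def)
  then have A: "- A \<in> so_mat"
    by (simp add: subspace_neg[OF subspace_so_mat])
  have "y = gen_H - x"
    unfolding \<open>gen_H = x + y\<close> by (rule add_diff_cancel_left'[symmetric])
  then have y_eq: "y = (0, 1, - c, 0, - d, - k, - A)"
    by (simp add: x_eq gen_defs)
  \<comment> \<open>A unit vector in an arbitrary coordinate direction; one exists because d is at
    least 1.\<close>
  define e :: "real^'n" where "e = axis undefined 1"
  let ?D = "(0, 0, 0, 0, e, 0, 0) :: 'n amb"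
  have D: "?D \<in> amb_CDKJ"
    by (simp add: amb_CDKJ_def subspace_0[OF subspace_so_mat])
  have br: "amb_bracket r \<epsilon> \<omega> ?D y = (0, 0, - (e \<bullet> k), 0, - (r *\<^sub>R e) - (- A) *v e, 0, 0)"
    by (simp add: y_eq)
  \<comment> \<open>The P component of \<open>y\<close> is 0, so [D,P] = M contributes nothing and
    the bracket stays in h.\<close>
  have "amb_bracket r \<epsilon> \<omega> ?D y \<in> amb_CDKJ"
    unfolding br by (simp add: amb_CDKJ_def subspace_0[OF subspace_so_mat])
  with inv[OF D y] int have "amb_bracket r \<epsilon> \<omega> ?D y = 0"
    by blast
  \<comment> \<open>Pairing the D component with \<open>e\<close> removes the unknown skew matrix
    and isolates r.\<close>
  then have "e \<bullet> (- (r *\<^sub>R e) - (- A) *v e) = 0"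
    unfolding br by (simp add: zero_prod_def)
  moreover have "e \<bullet> ((- A) *v e) = 0"
    using so_mat_inner[OF A, of e e] by (simp add: inner_commute)
  ultimately have "r * (e \<bullet> e) = 0"
    by (simp add: inner_diff_right)
  then show False
    using assms by (simp add: e_def inner_axis_axis)
qed

theorem mainTheorem5:
  fixes r \<epsilon> \<omega> :: real
  assumes "(\<epsilon>, \<omega>) \<in> {(0, 0), (0, 1), (1, 0), (-1, 0)}
             \<union> {(1, \<alpha>) | \<alpha>. \<alpha> > 0} \<union> {(-1, \<alpha>) | \<alpha>. \<alpha> > 0}"
  shows "let g = (amb_algebra r \<epsilon> \<omega> :: (real, 'n::finite amb) module);
             h = amb_CDKJ;
             i = amb_MCD;
             \<xi> = h +>\<^bsub>g\<^esub> gen_M;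
             \<psi> = (\<lambda>S. - dual_H S);
             \<gamma> = (\<lambda>S T. \<Sum>j\<in>UNIV. dual_P j S * dual_P j T)
         in lie_algebra g \<and>
            projectable_triplet g h i \<and>
            lifts_klein_pair g h i (gal_algebra \<epsilon> \<omega> :: (real, 'n kin) module) gal_KJ \<and>
            leibnizian g h \<xi> \<psi> \<gamma> \<and>
            (r = 0 \<longrightarrow> reductive_klein_pair g h) \<and>
            (r \<noteq> 0 \<longrightarrow> \<not> reductive_klein_pair g h)"
  using lie_algebra_amb[of r \<epsilon> \<omega>] projectable_amb[of r \<epsilon> \<omega>] lifts_amb[of r \<epsilon> \<omega>]
    leibnizian_amb[of r \<epsilon> \<omega>] reductive_amb[of \<epsilon> \<omega>] not_reductive_amb[of r \<epsilon> \<omega>]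
  unfolding Let_def by blast

end
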